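(* For any real $\alpha > 1$, the Rademacher random walk with step sizes $a_n = \lfloor (\log n)^\alpha\rfloor$, $n\ge 1$, is transient.
   Context: Let $\epsilon_1, \epsilon_2, \dots$ be independent Rademacher random variables, taking values $\pm 1$ each with probability $1/2$. The Rademacher random walk with step sizes $(a_n)_{n\ge1}$ (a deterministic sequence of non-negative reals) is $(X_n)_{n\ge 0}$, $X_n = \sum_{k=1}^n \epsilon_k a_k$. The walk is weakly recurrent if $\mathbb{P}(\exists C<\infty : |X_n| \le C \text{ for infinitely many } n) = 1$; otherwise it is called transient (the event is a tail event, so by Kolmogorov's zero-one law transience means its probability is $0$). Here $\log$ is the natural logarithm. *)

theory Defs
  imports "HOL-Probability.Probability"
begin

text \<open>
  The sequence starts at index 1; the value \<open>eps 0\<close> is unconstrained and never used.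
\<close>

locale rademacher_sequence = prob_space M for M :: "'a measure" +
  fixes eps :: "nat \<Rightarrow> 'a \<Rightarrow> real"
  assumes indep_eps: "indep_vars (\<lambda>_. borel) eps {1..}"
    and prob_eps_1: "\<And>n. n \<ge> 1 \<Longrightarrow> \<P>(\<omega> in M. eps n \<omega> = 1) = 1 / 2"
    and prob_eps_minus_1: "\<And>n. n \<ge> 1 \<Longrightarrow> \<P>(\<omega> in M. eps n \<omega> = - 1) = 1 / 2"

definition rademacher_walk ::
    "(nat \<Rightarrow> 'a \<Rightarrow> real) \<Rightarrow> (nat \<Rightarrow> real) \<Rightarrow> nat \<Rightarrow> 'a \<Rightarrow> real" where
  "rademacher_walk eps a n \<omega> = (\<Sum>k=1..n. eps k \<omega> * a k)"

definition weakly_recurrent :: "'a measure \<Rightarrow> (nat \<Rightarrow> 'a \<Rightarrow> real) \<Rightarrow> bool" where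
  "weakly_recurrent M X \<longleftrightarrow>
    \<P>(\<omega> in M. \<exists>C::real. \<exists>\<^sub>\<infinity>n. \<bar>X n \<omega>\<bar> \<le> C) = 1"

definition transient :: "'a measure \<Rightarrow> (nat \<Rightarrow> 'a \<Rightarrow> real) \<Rightarrow> bool" where
  "transient M X \<longleftrightarrow> \<not> weakly_recurrent M X"

text \<open>
  A set outside the sigma-algebra has \<open>measure\<close> 0 by convention.  The next lemma shows
  that the event defining weak recurrence of a Rademacher walk is measurable, so
  transience never holds merely because of that convention.
\<close>

lemma (in rademacher_sequence) weak_recurrence_event_measurable:
  "{\<omega> \<in> space M. \<exists>C::real. \<exists>\<^sub>\<infinity>n. \<bar>rademacher_walk eps a n \<omega>\<bar> \<le> C} \<in> sets M"
proof -
  have eps: "eps k \<in> borel_measurable M" if "k \<ge> 1" for k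
    using indep_eps that by (auto simp: indep_vars_def)
  have [measurable]: "rademacher_walk eps a n \<in> borel_measurable M" for n
    unfolding rademacher_walk_def [abs_def] using eps by (intro borel_measurable_sum) auto
  have "(\<exists>C::real. \<exists>\<^sub>\<infinity>n. \<bar>x n\<bar> \<le> C) \<longleftrightarrow>
        (\<exists>N::nat. \<forall>m. \<exists>n\<in>{m<..}. \<bar>x n\<bar> \<le> real N)" for x :: "nat \<Rightarrow> real"
  proof
    assume "\<exists>C::real. \<exists>\<^sub>\<infinity>n. \<bar>x n\<bar> \<le> C"
    then obtain C where C: "\<exists>\<^sub>\<infinity>n. \<bar>x n\<bar> \<le> C" by blast
    obtain N :: nat where "C \<le> real N" using real_arch_simple by blast
    with C show "\<exists>N::nat. \<forall>m. \<exists>n\<in>{m<..}. \<bar>x n\<bar> \<le> real N"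
      unfolding INFM_nat by (meson greaterThan_iff order_trans)
  next
    assume "\<exists>N::nat. \<forall>m. \<exists>n\<in>{m<..}. \<bar>x n\<bar> \<le> real N"
    then show "\<exists>C::real. \<exists>\<^sub>\<infinity>n. \<bar>x n\<bar> \<le> C"
      unfolding INFM_nat by (meson greaterThan_iff)
  qed
  then show ?thesis by simp
qed

end

theory Submission
  imports Defs "HOL-Real_Asymp.Real_Asymp"
begin

text \<open>
  The step size is constant, equal to \<open>k\<close>, on the block of times \<open>n\<close> with
  \<open>exp (k powr \<beta>) \<le> n < exp ((k + 1) powr \<beta>)\<close>, where \<open>\<beta> = 1 / \<alpha> < 1\<close>. Write \<open>N\<close> for the time
  before the block and \<open>L\<close> for its length, so that \<open>L / N\<close> is of order \<open>k powr (\<beta> - 1)\<close>.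

  Summing the return probabilities over single times fails, because \<open>X n\<close> is near \<open>0\<close> with
  probability of order \<open>1 / (k * sqrt n)\<close>, which is not summable. Block by block it succeeds.
  Inside a block the walk is a simple random walk of step \<open>k\<close>. To come within \<open>C\<close> of the
  origin it must enter the block at a point \<open>c - j * k\<close> with \<open>\<bar>c\<bar> \<le> C\<close> and then cover \<open>j\<close> steps
  net, and only \<open>\<bar>j\<bar>\<close> up to about \<open>sqrt L\<close> is likely. If every single point has probability
  \<open>O(1 / (k * sqrt N))\<close> at time \<open>N\<close>, the block is visited with probability
  \<open>O(sqrt L / (k * sqrt N))\<close>, which is \<open>O(k powr ((\<beta> - 3) / 2))\<close>. This is summable precisely
  because \<open>\<beta> < 1\<close>, and the Borel-Cantelli lemma gives transience.

  Two estimates carry the argument. The bound on point probabilities (\<open>prob_walk_eq_le\<close>) comes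
  from the characteristic function \<open>\<Prod>i. cos (a i * t)\<close>: near \<open>0\<close> and \<open>\<pi>\<close> it is dominated by a
  Gaussian, and away from them two consecutive step sizes, each used very often, make it tiny. The
  bound on the excursion inside a block (\<open>prob_past_hit_le\<close>) says that the simple random walk
  reaches level \<open>j\<close> within \<open>L\<close> steps with probability at most \<open>L / j\<^sup>2\<close>; since
  \<open>\<Sum>j. min 1 (L / j\<^sup>2)\<close> is \<open>O(sqrt L)\<close>, no factor is lost.
\<close>

section \<open>Conditioning on the past of a Rademacher sequence\<close>

context rademacher_sequence
begin

lemma eps_measurable [measurable]: "eps n \<in> borel_measurable M" if "n \<ge> 1"
  using indep_eps that by (auto simp: indep_vars_def)

lemma walk_measurable [measurable]: "rademacher_walk eps a n \<in> borel_measurable M"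
  unfolding rademacher_walk_def [abs_def]
  by (intro borel_measurable_sum borel_measurable_times eps_measurable) auto

definition past :: "nat \<Rightarrow> 'a measure" where
  "past n = sigma (space M) (\<Union>i\<in>{1..n}. {eps i -` B \<inter> space M | B. B \<in> sets borel})"

lemma space_past [simp]: "space (past n) = space M"
  unfolding past_def by (rule space_measure_of) auto

lemma sets_past:
  "sets (past n) = sigma_sets (space M) (\<Union>i\<in>{1..n}. {eps i -` B \<inter> space M | B. B \<in> sets borel})"
  unfolding past_def by (rule sets_measure_of) auto

lemma past_subset_events: "A \<in> sets (past n) \<Longrightarrow> A \<in> events"
  unfolding sets_past
  by (erule subsetD [OF sets.sigma_sets_subset, rotated])
     (auto intro!: measurable_sets [OF eps_measurable])

lemma past_Suc: "A \<in> sets (past n) \<Longrightarrow> A \<in> sets (past (Suc n))"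
  unfolding sets_past
  by (erule subsetD [OF sigma_sets_subseteq, rotated]) (intro UN_mono, auto)

lemma eps_past: "eps i \<in> borel_measurable (past n)" if "1 \<le> i" "i \<le> n"
proof (rule measurableI)
  fix B :: "real set" assume "B \<in> sets borel"
  then show "eps i -` B \<inter> space (past n) \<in> sets (past n)"
    using that unfolding sets_past space_past by (intro sigma_sets.Basic UN_I[of i]) auto
qed auto

lemma walk_past: "rademacher_walk eps a n \<in> borel_measurable (past n)"
  unfolding rademacher_walk_def [abs_def]
  by (intro borel_measurable_sum borel_measurable_times eps_past) auto

text \<open>
  The next sign is a fair coin, independent of everything in the sigma-algebra of the first \<open>n\<close>
  signs. All later recursions in the number of steps rest on this fact.
\<close>

lemma prob_past_step:
  assumes A: "A \<in> sets (past n)" and s: "s = 1 \<or> s = - 1"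
  shows "prob (A \<inter> {\<omega> \<in> space M. eps (Suc n) \<omega> = s}) = prob A / 2"
proof -
  let ?E = "\<lambda>i. {eps i -` B \<inter> space M | B. B \<in> sets borel}"
  let ?I = "\<lambda>b. if b then {1..n} else {Suc n}"
  let ?S = "{\<omega> \<in> space M. eps (Suc n) \<omega> = s}"
  have S_eq: "?S = eps (Suc n) -` {s} \<inter> space M" by auto
  have "indep_sets (\<lambda>b. sigma_sets (space M) (\<Union>i\<in>?I b. ?E i)) UNIV"
  proof (rule indep_sets_collect_sigma [where I = ?I and J = UNIV and E = ?E])
    show "indep_sets ?E (\<Union>b\<in>UNIV. ?I b)"
    proof (rule indep_sets_mono_index)
      show "indep_sets ?E {1..}" using indep_eps by (simp add: indep_vars_def2)
    qed auto
    show "Int_stable (?E i)" for i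
      unfolding Int_stable_def
    proof safe
      fix B C :: "real set" assume "B \<in> sets borel" "C \<in> sets borel"
      then show "\<exists>D. eps i -` B \<inter> space M \<inter> (eps i -` C \<inter> space M) = eps i -` D \<inter> space M \<and> D \<in> sets borel"
        by (intro exI[of _ "B \<inter> C"]) auto
    qed
    show "disjoint_family_on ?I UNIV"
      by (auto simp: disjoint_family_on_def)
  qed
  then have "prob (\<Inter>b\<in>UNIV. if b then A else ?S) = (\<Prod>b\<in>UNIV. prob (if b then A else ?S))"
  proof (rule indep_setsD [where A = "\<lambda>b. if b then A else ?S" and J = UNIV])
    show "\<forall>b\<in>UNIV. (if b then A else ?S) \<in> sigma_sets (space M) (\<Union>i\<in>?I b. ?E i)"
    proof safe
      fix b :: bool
      show "(if b then A else ?S) \<in> sigma_sets (space M) (\<Union>i\<in>?I b. ?E i)"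
      proof (cases b)
        case True
        then show ?thesis using A unfolding sets_past by simp
      next
        case False
        have "?S \<in> ?E (Suc n)" unfolding S_eq mem_Collect_eq by (intro exI [of _ "{s}"]) simp
        with False show ?thesis by (simp add: sigma_sets.Basic)
      qed
    qed
  qed auto
  moreover have "prob ?S = 1 / 2"
    using s prob_eps_1[of "Suc n"] prob_eps_minus_1[of "Suc n"] by auto
  moreover have "(\<Inter>b\<in>UNIV. if b then A else ?S) = A \<inter> ?S"
    by (auto split: if_splits)
  ultimately show ?thesis by (simp add: UNIV_bool)
qed

text \<open>
  The two values \<open>\<plusminus>1\<close> exhaust the probability, so all other values form a null set.
\<close>

lemma AE_eps_sign: "AE \<omega> in M. \<forall>n\<ge>1. eps n \<omega> = 1 \<or> eps n \<omega> = - 1"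
proof -
  have "AE \<omega> in M. n \<ge> 1 \<longrightarrow> eps n \<omega> = 1 \<or> eps n \<omega> = - 1" for n
  proof (cases "n \<ge> 1")
    case True
    note [measurable] = eps_measurable[OF True]
    have "prob ({\<omega> \<in> space M. eps n \<omega> = 1} \<union> {\<omega> \<in> space M. eps n \<omega> = - 1}) = 1"
      using prob_eps_1[OF True] prob_eps_minus_1[OF True]
      by (subst finite_measure_Union) auto
    also have "{\<omega> \<in> space M. eps n \<omega> = 1} \<union> {\<omega> \<in> space M. eps n \<omega> = - 1} =
        {\<omega> \<in> space M. eps n \<omega> = 1 \<or> eps n \<omega> = - 1}" by auto
    finally have "AE \<omega> in M. eps n \<omega> = 1 \<or> eps n \<omega> = - 1"
      using True by (subst (asm) prob_Collect_eq_1) auto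
    then show ?thesis by auto
  qed auto
  then show ?thesis by (simp add: AE_all_countable)
qed

lemma prob_split_eps:
  assumes A: "A \<in> events" and n: "n \<ge> 1"
  shows "prob A = prob (A \<inter> {\<omega> \<in> space M. eps n \<omega> = 1}) + prob (A \<inter> {\<omega> \<in> space M. eps n \<omega> = - 1})"
proof -
  note [measurable] = eps_measurable[OF n] A
  have "prob A = prob (A \<inter> {\<omega> \<in> space M. eps n \<omega> = 1} \<union> A \<inter> {\<omega> \<in> space M. eps n \<omega> = - 1})"
    by (rule finite_measure_eq_AE) (use AE_eps_sign n sets.sets_into_space[OF A] in auto)
  also have "\<dots> = prob (A \<inter> {\<omega> \<in> space M. eps n \<omega> = 1}) + prob (A \<inter> {\<omega> \<in> space M. eps n \<omega> = - 1})"
    by (rule finite_measure_Union) auto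
  finally show ?thesis .
qed

lemma rademacher_walk_Suc:
  "rademacher_walk eps a (Suc n) \<omega> = rademacher_walk eps a n \<omega> + eps (Suc n) \<omega> * a (Suc n)"
  by (simp add: rademacher_walk_def)

lemma prob_walk_Suc:
  "\<P>(\<omega> in M. rademacher_walk eps a (Suc n) \<omega> = x) =
    (\<P>(\<omega> in M. rademacher_walk eps a n \<omega> = x - a (Suc n)) +
     \<P>(\<omega> in M. rademacher_walk eps a n \<omega> = x + a (Suc n))) / 2"
proof -
  let ?X = "rademacher_walk eps a"
  have past: "{\<omega> \<in> space M. ?X n \<omega> = y} \<in> sets (past n)" for y
    using measurable_sets[OF walk_past, of "{y}" a n] by (simp add: vimage_def Int_def conj_commute)
  have step: "prob ({\<omega> \<in> space M. ?X (Suc n) \<omega> = x} \<inter> {\<omega> \<in> space M. eps (Suc n) \<omega> = s}) =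
      \<P>(\<omega> in M. ?X n \<omega> = x - s * a (Suc n)) / 2" if "s = 1 \<or> s = - 1" for s
  proof -
    have "{\<omega> \<in> space M. ?X (Suc n) \<omega> = x} \<inter> {\<omega> \<in> space M. eps (Suc n) \<omega> = s} =
        {\<omega> \<in> space M. ?X n \<omega> = x - s * a (Suc n)} \<inter> {\<omega> \<in> space M. eps (Suc n) \<omega> = s}"
      by (auto simp: rademacher_walk_Suc)
    then show ?thesis using prob_past_step[OF past that] by simp
  qed
  have "\<P>(\<omega> in M. ?X (Suc n) \<omega> = x) =
      prob ({\<omega> \<in> space M. ?X (Suc n) \<omega> = x} \<inter> {\<omega> \<in> space M. eps (Suc n) \<omega> = 1}) +
      prob ({\<omega> \<in> space M. ?X (Suc n) \<omega> = x} \<inter> {\<omega> \<in> space M. eps (Suc n) \<omega> = - 1})"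
    by (rule prob_split_eps) auto
  also have "\<dots> = (\<P>(\<omega> in M. ?X n \<omega> = x - a (Suc n)) + \<P>(\<omega> in M. ?X n \<omega> = x + a (Suc n))) / 2"
    using step[of 1] step[of "- 1"] by (simp add: add_divide_distrib)
  finally show ?thesis .
qed

end

section \<open>Point probabilities by Fourier inversion\<close>

text \<open>
  Fourier inversion on the integer lattice. As the distribution is symmetric, the characteristic
  function is real and even, and half a period suffices. Conditioning on the last sign turns into
  the product formula for cosines, which gives the proof by induction on the number of steps.
\<close>

lemma (in rademacher_sequence) prob_walk_eq_integral:
  assumes a: "\<And>i. a i \<in> \<int>" and x: "x \<in> \<int>"
  shows "((\<lambda>t. cos (x * t) * (\<Prod>i=1..n. cos (a i * t))) has_integral
           pi * \<P>(\<omega> in M. rademacher_walk eps a n \<omega> = x)) {0..pi}"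
  using x
proof (induction n arbitrary: x)
  case 0
  show ?case
  proof (cases "x = 0")
    case True
    then show ?thesis
      using has_integral_const_real[of "1::real" 0 pi]
      by (simp add: rademacher_walk_def prob_space)
  next
    case False
    from 0 obtain m :: int where m: "x = of_int m" by (auto elim: Ints_cases)
    have "((\<lambda>t. cos (x * t)) has_integral (sin (x * pi) / x - sin (x * 0) / x)) {0..pi}"
      using False
      by (intro fundamental_theorem_of_calculus)
         (auto intro!: derivative_eq_intros simp flip: has_real_derivative_iff_has_vector_derivative)
    moreover have "sin (x * pi) = 0"
      unfolding m sin_zero_iff_int2 by blast
    ultimately show ?thesis using False by (simp add: rademacher_walk_def)
  qed
next
  case (Suc n)
  let ?P = "\<lambda>t. \<Prod>i=1..n. cos (a i * t)"
  let ?p = "\<lambda>y. \<P>(\<omega> in M. rademacher_walk eps a n \<omega> = y)"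
  have "((\<lambda>t. (cos ((x - a (Suc n)) * t) * ?P t + cos ((x + a (Suc n)) * t) * ?P t) / 2) has_integral
      (pi * ?p (x - a (Suc n)) + pi * ?p (x + a (Suc n))) / 2) {0..pi}"
    using Suc.prems a by (intro has_integral_divide has_integral_add Suc.IH) auto
  also have "(\<lambda>t. (cos ((x - a (Suc n)) * t) * ?P t + cos ((x + a (Suc n)) * t) * ?P t) / 2) =
      (\<lambda>t. cos (x * t) * (\<Prod>i=1..Suc n. cos (a i * t)))"
    by (rule ext) (simp add: cos_add cos_diff algebra_simps)
  also have "(pi * ?p (x - a (Suc n)) + pi * ?p (x + a (Suc n))) / 2 =
      pi * \<P>(\<omega> in M. rademacher_walk eps a (Suc n) \<omega> = x)"
    unfolding prob_walk_Suc by (simp add: algebra_simps)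
  finally show ?case .
qed

lemma abs_cos_le_exp_sin: "\<bar>cos u\<bar> \<le> exp (- (sin u)\<^sup>2 / 2)" for u :: real
proof (rule power2_le_imp_le)
  have "\<bar>cos u\<bar>\<^sup>2 = 1 + - (sin u)\<^sup>2" by (simp add: cos_squared_eq)
  also have "\<dots> \<le> exp (- (sin u)\<^sup>2)" by (rule exp_ge_add_one_self)
  also have "\<dots> = (exp (- (sin u)\<^sup>2 / 2))\<^sup>2" by (simp flip: exp_double)
  finally show "\<bar>cos u\<bar>\<^sup>2 \<le> (exp (- (sin u)\<^sup>2 / 2))\<^sup>2" .
qed auto

lemma abs_prod_cos_le:
  "\<bar>\<Prod>i\<in>I. cos (a i * t)\<bar> \<le> exp (- (\<Sum>i\<in>I. (sin (a i * t))\<^sup>2) / 2)" for a :: "'i \<Rightarrow> real"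
proof (cases "finite I")
  case True
  have "\<bar>\<Prod>i\<in>I. cos (a i * t)\<bar> \<le> (\<Prod>i\<in>I. exp (- (sin (a i * t))\<^sup>2 / 2))"
    unfolding abs_prod by (intro prod_mono conjI abs_cos_le_exp_sin abs_ge_zero)
  also have "\<dots> = exp (- (\<Sum>i\<in>I. (sin (a i * t))\<^sup>2) / 2)"
    using True by (simp flip: exp_sum add: sum_negf sum_divide_distrib)
  finally show ?thesis .
qed simp

lemma sin_ge_chord: "2 * u / pi \<le> sin u" if "0 \<le> u" "u \<le> pi / 2"
proof -
  have "concave_on {0..pi/2} sin"
    unfolding concave_on_def
    by (rule f''_ge0_imp_convex[where f' = "\<lambda>x. - cos x" and f'' = sin])
       (auto intro!: derivative_eq_intros sin_ge_zero)
  from concave_onD[OF this, of "2 * u / pi" 0 "pi/2"] that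
  show ?thesis by (simp add: field_simps)
qed

text \<open>
  Two consecutive step sizes cannot both be resonant at \<open>t\<close> unless \<open>t\<close> is near a multiple of
  \<open>\<pi>\<close>: this is the addition formula for
  \<open>t = (j + 1) * t - j * t\<close>.
\<close>

lemma sin_sq_le_consecutive: "(sin t)\<^sup>2 / 2 \<le> (sin (j * t))\<^sup>2 + (sin ((j + 1) * t))\<^sup>2" for j t :: real
proof -
  let ?s = "sin (j * t)" and ?s' = "sin ((j + 1) * t)"
  have "sin t = sin ((j + 1) * t - j * t)" by (simp add: algebra_simps)
  also have "\<dots> = ?s' * cos (j * t) - cos ((j + 1) * t) * ?s" by (rule sin_diff)
  finally have "\<bar>sin t\<bar> \<le> \<bar>?s'\<bar> * \<bar>cos (j * t)\<bar> + \<bar>cos ((j + 1) * t)\<bar> * \<bar>?s\<bar>"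
    by (simp flip: abs_mult)
  also have "\<dots> \<le> \<bar>?s'\<bar> * 1 + 1 * \<bar>?s\<bar>"
    by (intro add_mono mult_mono) auto
  finally have "\<bar>sin t\<bar>\<^sup>2 \<le> (\<bar>?s'\<bar> + \<bar>?s\<bar>)\<^sup>2" by (intro power_mono) auto
  also have "\<dots> \<le> 2 * (?s\<^sup>2 + ?s'\<^sup>2)"
    using sum_squares_bound[of "\<bar>?s\<bar>" "\<bar>?s'\<bar>"] by (simp add: power2_sum mult_ac)
  finally show ?thesis by simp
qed

text \<open>
  For \<open>t \<le> \<pi> / (2 * k)\<close> no angle \<open>a i * t\<close> exceeds \<open>\<pi> / 2\<close>, so every sine is comparable to its
  argument and the product decays like \<open>exp (- c * D\<^sup>2 * t\<^sup>2)\<close>; the weaker Cauchy profile has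
  an elementary primitive. For larger \<open>t\<close> the many steps of sizes \<open>j\<close> and \<open>j + 1\<close> give an
  exponentially small bound, because \<open>sin t \<ge> 1 / k\<close> there.
\<close>

lemma abs_prod_cos_le_first_quadrant:
  fixes a :: "nat \<Rightarrow> real"
  assumes a: "\<And>i. i \<in> {1..n} \<Longrightarrow> 0 \<le> a i \<and> a i \<le> k" and k: "k > 0"
    and D: "D\<^sup>2 \<le> (\<Sum>i=1..n. (a i)\<^sup>2)"
    and m: "m \<le> card {i\<in>{1..n}. a i = j}" "m \<le> card {i\<in>{1..n}. a i = j + 1}"
    and t: "0 \<le> t" "t \<le> pi / 2"
  shows "\<bar>\<Prod>i=1..n. cos (a i * t)\<bar> \<le> 1 / (1 + (D / 3 * t)\<^sup>2) + exp (- (real m / (4 * k\<^sup>2)))"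
proof -
  let ?S = "\<Sum>i=1..n. (sin (a i * t))\<^sup>2"
  have le: "\<bar>\<Prod>i=1..n. cos (a i * t)\<bar> \<le> exp (- ?S / 2)" by (rule abs_prod_cos_le)
  show ?thesis
  proof (cases "k * t \<le> pi / 2")
    case True
    have pi: "pi\<^sup>2 \<le> 18"
      using pi_approx power_mono[of pi "3.15" 2] by (simp add: power2_eq_square)
    have "2 * (D / 3 * t)\<^sup>2 \<le> (2 * t / pi)\<^sup>2 * D\<^sup>2"
    proof -
      have "2 * (D / 3 * t)\<^sup>2 = (D * t)\<^sup>2 * (4 / 18)" by (simp add: power_mult_distrib power_divide)
      also have "\<dots> \<le> (D * t)\<^sup>2 * (4 / pi\<^sup>2)"
        using pi by (intro mult_left_mono divide_left_mono) auto
      also have "\<dots> = (2 * t / pi)\<^sup>2 * D\<^sup>2" by (simp add: power_mult_distrib power_divide)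
      finally show ?thesis .
    qed
    also have "\<dots> \<le> (2 * t / pi)\<^sup>2 * (\<Sum>i=1..n. (a i)\<^sup>2)"
      using D by (intro mult_left_mono) auto
    also have "\<dots> = (\<Sum>i=1..n. (2 * (a i * t) / pi)\<^sup>2)"
      by (simp add: sum_distrib_left sum_divide_distrib power_mult_distrib power_divide mult_ac)
    also have "\<dots> \<le> ?S"
    proof (intro sum_mono power_mono sin_ge_chord)
      fix i assume i: "i \<in> {1..n}"
      show "0 \<le> a i * t" using a[OF i] t by auto
      have "a i * t \<le> k * t" using a[OF i] t by (intro mult_right_mono) auto
      then show "a i * t \<le> pi / 2" using True by simp
      show "0 \<le> 2 * (a i * t) / pi" using a[OF i] t by auto
    qed
    finally have "(D / 3 * t)\<^sup>2 \<le> ?S / 2" by simp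
    then have "exp (- ?S / 2) \<le> exp (- ((D / 3 * t)\<^sup>2))" by simp
    also have "\<dots> = 1 / exp ((D / 3 * t)\<^sup>2)" by (simp add: exp_minus field_simps)
    also have "\<dots> \<le> 1 / (1 + (D / 3 * t)\<^sup>2)"
      by (intro divide_left_mono exp_ge_add_one_self mult_pos_pos) (auto intro: add_pos_nonneg)
    finally have "exp (- ?S / 2) \<le> 1 / (1 + (D / 3 * t)\<^sup>2)" .
    with le show ?thesis by (smt (verit) exp_ge_zero)
  next
    case False
    let ?U = "{i\<in>{1..n}. a i = j}" and ?V = "{i\<in>{1..n}. a i = j + 1}"
    have "1 / k \<le> 2 * t / pi" using False k by (simp add: field_simps)
    also have "\<dots> \<le> sin t" using t by (rule sin_ge_chord)
    finally have "(1 / k)\<^sup>2 \<le> (sin t)\<^sup>2" using k by (intro power_mono) auto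
    then have "real m / (2 * k\<^sup>2) \<le> real m * ((sin t)\<^sup>2 / 2)"
      using mult_left_mono[of "(1/k)\<^sup>2" "(sin t)\<^sup>2" "real m / 2"] by (simp add: power_divide)
    also have "\<dots> \<le> real m * ((sin (j * t))\<^sup>2 + (sin ((j + 1) * t))\<^sup>2)"
      by (intro mult_left_mono sin_sq_le_consecutive) auto
    also have "\<dots> \<le> real (card ?U) * (sin (j * t))\<^sup>2 + real (card ?V) * (sin ((j + 1) * t))\<^sup>2"
      using m unfolding distrib_left by (intro add_mono mult_right_mono) auto
    also have "\<dots> = (\<Sum>i\<in>?U. (sin (a i * t))\<^sup>2) + (\<Sum>i\<in>?V. (sin (a i * t))\<^sup>2)"
      by simp
    also have "\<dots> = (\<Sum>i\<in>?U \<union> ?V. (sin (a i * t))\<^sup>2)"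
      by (rule sum.union_disjoint [symmetric]) auto
    also have "\<dots> \<le> ?S" by (intro sum_mono2) auto
    finally have "real m / (2 * k\<^sup>2) / 2 \<le> ?S / 2" by (rule divide_right_mono) simp
    then have "exp (- ?S / 2) \<le> exp (- (real m / (4 * k\<^sup>2)))" by simp
    moreover have "0 \<le> 1 / (1 + (D / 3 * t)\<^sup>2)" by simp
    ultimately show ?thesis using le by linarith
  qed
qed

text \<open>
  Integer steps cannot distinguish the frequencies \<open>t\<close> and \<open>\<pi> - t\<close>, up to sign: the walk lives on
  a fixed parity class at each time. Hence the peak of the characteristic function at \<open>0\<close> is
  repeated at \<open>\<pi>\<close>.
\<close>

lemma abs_prod_cos_reflect:
  fixes a :: "nat \<Rightarrow> real"
  assumes "\<And>i. a i \<in> \<int>"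
  shows "\<bar>\<Prod>i\<in>I. cos (a i * (pi - t))\<bar> = \<bar>\<Prod>i\<in>I. cos (a i * t)\<bar>"
  unfolding abs_prod
proof (rule prod.cong[OF refl])
  fix i
  obtain z where z: "a i = of_int z" using assms[of i] by (auto elim: Ints_cases)
  have "sin (pi * of_int z) = 0" by (simp add: sin_zero_iff_int2)
  moreover from this have "\<bar>cos (pi * of_int z)\<bar> = 1"
    using sin_cos_squared_add[of "pi * of_int z"] by (simp add: power2_eq_1_iff)
  ultimately show "\<bar>cos (a i * (pi - t))\<bar> = \<bar>cos (a i * t)\<bar>"
    unfolding z by (simp add: right_diff_distrib cos_diff abs_mult mult.commute[of _ pi])
qed

text \<open>
  The two peaks of width \<open>1 / D\<close>, at \<open>0\<close> and \<open>\<pi>\<close>, contribute the term \<open>3 / D\<close>. Here \<open>D\<close> is a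
  lower bound for the standard deviation of the walk, so this is the order that a local limit
  theorem would give.
\<close>

lemma (in rademacher_sequence) prob_walk_eq_le:
  assumes int: "\<And>i. a i \<in> \<int>" and x: "x \<in> \<int>"
    and a: "\<And>i. i \<in> {1..n} \<Longrightarrow> 0 \<le> a i \<and> a i \<le> k" and k: "k > 0"
    and D: "D > 0" "D\<^sup>2 \<le> (\<Sum>i=1..n. (a i)\<^sup>2)"
    and m: "m \<le> card {i\<in>{1..n}. a i = j}" "m \<le> card {i\<in>{1..n}. a i = j + 1}"
  shows "\<P>(\<omega> in M. rademacher_walk eps a n \<omega> = x) \<le> 3 / D + exp (- (real m / (4 * k\<^sup>2)))"
proof -
  let ?e = "exp (- (real m / (4 * k\<^sup>2)))"
  define N where "N = D / 3"
  have N: "N > 0" using D by (simp add: N_def)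
  let ?g = "\<lambda>t. 1 / (1 + (N * t)\<^sup>2) + 1 / (1 + (N * (pi - t))\<^sup>2) + ?e"
  let ?G = "\<lambda>t. arctan (N * t) / N - arctan (N * (pi - t)) / N + ?e * t"
  have g: "(?g has_integral ?G pi - ?G 0) {0..pi}"
  proof (rule fundamental_theorem_of_calculus)
    fix t :: real
    have pos: "1 + (N * s)\<^sup>2 \<noteq> 0" for s by (smt (verit) zero_le_power2)
    have "(?G has_real_derivative ?g t) (at t within {0..pi})"
      using N pos by (auto intro!: derivative_eq_intros simp: field_simps)
    then show "(?G has_vector_derivative ?g t) (at t within {0..pi})"
      by (simp add: has_real_derivative_iff_has_vector_derivative)
  qed simp
  have "cos (x * t) * (\<Prod>i=1..n. cos (a i * t)) \<le> ?g t" if t: "t \<in> {0..pi}" for t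
  proof -
    have "\<bar>cos (x * t)\<bar> * \<bar>\<Prod>i=1..n. cos (a i * t)\<bar> \<le> 1 * \<bar>\<Prod>i=1..n. cos (a i * t)\<bar>"
      by (intro mult_right_mono) auto
    then have "cos (x * t) * (\<Prod>i=1..n. cos (a i * t)) \<le> \<bar>\<Prod>i=1..n. cos (a i * t)\<bar>"
      unfolding abs_mult[symmetric] by simp
    also have "\<dots> \<le> ?g t"
    proof (cases "t \<le> pi / 2")
      case True
      have "\<bar>\<Prod>i=1..n. cos (a i * t)\<bar> \<le> 1 / (1 + (N * t)\<^sup>2) + ?e"
        unfolding N_def using t True by (intro abs_prod_cos_le_first_quadrant [OF a k D(2) m]) auto
      moreover have "0 \<le> 1 / (1 + (N * (pi - t))\<^sup>2)" by simp
      ultimately show ?thesis by linarith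
    next
      case False
      have "\<bar>\<Prod>i=1..n. cos (a i * (pi - t))\<bar> \<le> 1 / (1 + (N * (pi - t))\<^sup>2) + ?e"
        unfolding N_def using t False by (intro abs_prod_cos_le_first_quadrant [OF a k D(2) m]) auto
      moreover have "0 \<le> 1 / (1 + (N * t)\<^sup>2)" by simp
      ultimately show ?thesis using abs_prod_cos_reflect[of a, OF int, where I = "{1..n}" and t = t] by linarith
    qed
    finally show ?thesis .
  qed
  from has_integral_le[OF prob_walk_eq_integral[OF int x] g this]
  have "pi * \<P>(\<omega> in M. rademacher_walk eps a n \<omega> = x) \<le> ?G pi - ?G 0" .
  also have "\<dots> = 2 * arctan (N * pi) / N + pi * ?e" by simp
  also have "\<dots> \<le> pi / N + pi * ?e"
    using arctan_ubound[of "N * pi"] N by (intro add_right_mono divide_right_mono) auto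
  also have "\<dots> = pi * (3 / D + ?e)" using N by (simp add: N_def field_simps)
  finally show ?thesis by simp
qed

section \<open>Visits of a simple random walk to a neighbourhood of the origin\<close>

text \<open>
  About \<open>sqrt L\<close> terms are cut off at \<open>1\<close>, and the tail behind them telescopes to another
  \<open>sqrt L\<close>.
\<close>

lemma sum_min_inverse_square_le:
  fixes L :: real
  assumes "L \<ge> 0"
  shows "(\<Sum>j=1..n. min 1 (L / (real j)\<^sup>2)) \<le> 2 * sqrt L"
proof -
  define s where "s = sqrt L"
  have s: "s \<ge> 0" "L = s\<^sup>2" using assms by (auto simp: s_def)
  \<comment> \<open>The strengthening by \<open>L / n\<close> makes the induction on the tail go through.\<close>
  have "(\<Sum>j=1..n. min 1 (L / (real j)\<^sup>2)) \<le> (if real n \<le> s then real n else 2 * s - L / real n)"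
  proof (induction n)
    case 0
    then show ?case using s by simp
  next
    case (Suc n)
    define t where "t = real (Suc n)"
    have t': "real (Suc n) = t" "real n = t - 1" by (simp_all add: t_def)
    have t: "t \<ge> 1" by (simp add: t_def)
    consider "t \<le> s" | "t - 1 \<le> s" "s < t" | "s < t - 1" by linarith
    then show ?case
    proof cases
      case 1
      then show ?thesis using Suc t by (simp add: t' del: of_nat_Suc)
    next
      case 2
      have "(t - 1) + L / t\<^sup>2 \<le> 2 * s - L / t"
      proof -
        have "(s - (t - 1)) * (t - s) * (t + 1) \<ge> 0" using 2 t by simp
        \<comment> \<open>The difference of both sides is convex in \<open>s\<close> and not positive at \<open>s = t - 1\<close> and \<open>s = t\<close>.\<close>
        moreover have "(t - 1) * t\<^sup>2 + s\<^sup>2 + s\<^sup>2 * t - 2 * s * t\<^sup>2 =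
          - ((s - (t - 1)) * (t - s) * (t + 1)) - (t - 1) * (t - s)"
          by (simp add: power2_eq_square algebra_simps)
        moreover have "(t - 1) * (t - s) \<ge> 0" using 2 t by simp
        ultimately have "(t - 1) * t\<^sup>2 + s\<^sup>2 + s\<^sup>2 * t - 2 * s * t\<^sup>2 \<le> 0" by linarith
        then have "((t - 1) * t\<^sup>2 + s\<^sup>2 + s\<^sup>2 * t - 2 * s * t\<^sup>2) / t\<^sup>2 \<le> 0"
          by (rule divide_nonpos_nonneg) simp
        also have "((t - 1) * t\<^sup>2 + s\<^sup>2 + s\<^sup>2 * t - 2 * s * t\<^sup>2) / t\<^sup>2 = (t - 1) + L / t\<^sup>2 + L / t - 2 * s"
          using t s by (simp add: field_simps power2_eq_square)
        finally show ?thesis by simp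
      qed
      moreover have "(\<Sum>j=1..n. min 1 (L / (real j)\<^sup>2)) \<le> t - 1" using Suc 2 by (simp add: t')
      ultimately show ?thesis using 2 t by (simp add: t' del: of_nat_Suc)
    next
      case 3
      have t1: "t - 1 > 0" using 3 s by linarith
      have "L / t\<^sup>2 \<le> L / ((t - 1) * t)"
        using t1 assms by (intro divide_left_mono) (auto simp: power2_eq_square)
      also have "\<dots> = L / (t - 1) - L / t" using t1 by (simp add: field_simps)
      finally show ?thesis using Suc 3 t by (simp add: t' del: of_nat_Suc)
    qed
  qed
  also have "\<dots> \<le> 2 * s" using s assms by auto
  finally show ?thesis by (simp add: s_def)
qed

context rademacher_sequence
begin

text \<open>
  A maximal inequality of Chebyshev type for the simple random walk that starts at \<open>w\<close> after time
  \<open>n\<close>, on an event determined by the first \<open>n\<close> signs. The numerator \<open>w\<^sup>2 + L\<close>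
  is the second moment after \<open>L\<close> steps. Its mean is preserved by one step, since
  \<open>((w + 1)\<^sup>2 + (w - 1)\<^sup>2) / 2 = w\<^sup>2 + 1\<close>, and it is at least \<open>y\<^sup>2\<close> once the target is hit.
\<close>

lemma prob_past_hit_le:
  fixes w y :: real
  assumes "A \<in> sets (past n)" and y: "y \<noteq> 0"
  shows "prob (A \<inter> {\<omega> \<in> space M. \<exists>m\<le>L. w + (\<Sum>i=n+1..n+m. eps i \<omega>) = y}) \<le>
    prob A * ((w\<^sup>2 + real L) / y\<^sup>2)"
  using assms(1)
proof (induction L arbitrary: A n w)
  case 0
  show ?case
  proof (cases "w = y")
    case True
    have "prob (A \<inter> {\<omega> \<in> space M. \<exists>m\<le>0. w + (\<Sum>i=n+1..n+m. eps i \<omega>) = y}) \<le> prob A"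
      using past_subset_events[OF "0"] by (intro finite_measure_mono) auto
    then show ?thesis using True y by simp
  qed simp
next
  case (Suc L)
  let ?H = "\<lambda>L n w. {\<omega> \<in> space M. \<exists>m\<le>L. w + (\<Sum>i=n+1..n+m. eps i \<omega>) = y}"
  let ?e = "\<lambda>s. {\<omega> \<in> space M. eps (Suc n) \<omega> = s}"
  have sum_meas: "(\<lambda>\<omega>. w + (\<Sum>i=n+1..n+m. eps i \<omega>)) \<in> borel_measurable M" for w n m
    by (intro borel_measurable_add borel_measurable_sum eps_measurable) auto
  have [measurable]: "?H L n w \<in> events" for L n w
  proof -
    have "?H L n w = (\<Union>m\<le>L. {\<omega> \<in> space M. w + (\<Sum>i=n+1..n+m. eps i \<omega>) = y})" by auto
    also have "\<dots> \<in> events"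
      by (intro sets.finite_UN finite_atMost borel_measurable_eq sum_meas borel_measurable_const)
    finally show ?thesis .
  qed
  have A [measurable]: "A \<in> events" by (rule past_subset_events[OF Suc.prems])
  show ?case
  proof (cases "w = y")
    case True
    have "prob (A \<inter> ?H (Suc L) n w) \<le> prob A * 1"
      using A by (simp add: finite_measure_mono)
    also have "\<dots> \<le> prob A * ((w\<^sup>2 + real (Suc L)) / y\<^sup>2)"
      using True y by (intro mult_left_mono) (auto simp: field_simps)
    finally show ?thesis .
  next
    case False
    have half: "prob (A \<inter> ?H (Suc L) n w \<inter> ?e s) \<le> prob A / 2 * (((w + s)\<^sup>2 + real L) / y\<^sup>2)"
      if s: "s = 1 \<or> s = - 1" for s
    proof -
      have sub: "A \<inter> ?H (Suc L) n w \<inter> ?e s \<subseteq> (A \<inter> ?e s) \<inter> ?H L (Suc n) (w + s)"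
      proof
        fix \<omega> assume \<omega>: "\<omega> \<in> A \<inter> ?H (Suc L) n w \<inter> ?e s"
        then obtain m where m: "m \<le> Suc L" and eq: "w + (\<Sum>i=n+1..n+m. eps i \<omega>) = y"
          and s: "s = eps (Suc n) \<omega>" by auto
        from False eq obtain m' where m': "m = Suc m'" by (cases m) auto
        have "(\<Sum>i=n+1..n+m. eps i \<omega>) = eps (Suc n) \<omega> + (\<Sum>i=Suc n+1..Suc n+m'. eps i \<omega>)"
          unfolding m' by (subst sum.atLeast_Suc_atMost) auto
        with eq m m' s have "\<exists>m\<le>L. w + s + (\<Sum>i=Suc n+1..Suc n+m. eps i \<omega>) = y"
          by (intro exI[of _ m']) auto
        with \<omega> show "\<omega> \<in> (A \<inter> ?e s) \<inter> ?H L (Suc n) (w + s)" by blast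
      qed
      have past: "A \<inter> ?e s \<in> sets (past (Suc n))"
      proof (rule sets.Int)
        show "A \<in> sets (past (Suc n))" by (rule past_Suc[OF Suc.prems])
        have "eps (Suc n) -` {s} \<inter> space (past (Suc n)) \<in> sets (past (Suc n))"
          by (rule measurable_sets[OF eps_past]) auto
        also have "eps (Suc n) -` {s} \<inter> space (past (Suc n)) = ?e s" by auto
        finally show "?e s \<in> sets (past (Suc n))" .
      qed
      have "prob (A \<inter> ?H (Suc L) n w \<inter> ?e s) \<le> prob ((A \<inter> ?e s) \<inter> ?H L (Suc n) (w + s))"
        using sub past_subset_events[OF past] by (intro finite_measure_mono) auto
      also have "\<dots> \<le> prob (A \<inter> ?e s) * (((w + s)\<^sup>2 + real L) / y\<^sup>2)"
        by (rule Suc.IH[OF past])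
      also have "prob (A \<inter> ?e s) = prob A / 2" by (rule prob_past_step[OF Suc.prems s])
      finally show ?thesis .
    qed
    have "prob (A \<inter> ?H (Suc L) n w) =
        prob (A \<inter> ?H (Suc L) n w \<inter> ?e 1) + prob (A \<inter> ?H (Suc L) n w \<inter> ?e (- 1))"
      by (rule prob_split_eps) auto
    also have "\<dots> \<le> prob A / 2 * (((w + 1)\<^sup>2 + real L) / y\<^sup>2) + prob A / 2 * (((w + - 1)\<^sup>2 + real L) / y\<^sup>2)"
      by (intro add_mono half) auto
    also have "\<dots> = prob A * ((w\<^sup>2 + real (Suc L)) / y\<^sup>2)"
      using y by (simp add: field_simps power2_eq_square)
    finally show ?thesis .
  qed
qed

text \<open>
  A visit to \<open>{- C..C}\<close> during a block of step size \<open>k\<close> determines the integer \<open>c\<close> where it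
  happens and the net number \<open>j\<close> of steps since the start of the block, hence the position
  \<open>c - j * k\<close> at that start. The union bound over \<open>c\<close> and \<open>j\<close> combines the bound \<open>p\<close> for the
  position with the maximal inequality for the excursion.
\<close>

lemma prob_block_visit_le:
  fixes C :: nat
  assumes int: "\<And>i. a i \<in> \<int>" and k: "k \<in> \<int>"
    and step: "\<And>i. i \<in> {n<..n + L} \<Longrightarrow> a i = k"
    and p: "\<And>x. x \<in> \<int> \<Longrightarrow> \<P>(\<omega> in M. rademacher_walk eps a n \<omega> = x) \<le> p"
  shows "\<P>(\<omega> in M. \<exists>i\<in>{n..n + L}. \<bar>rademacher_walk eps a i \<omega>\<bar> \<le> real C) \<le>
    (2 * real C + 1) * p * (1 + 4 * sqrt (real L))"
proof -
  let ?X = "rademacher_walk eps a"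
  let ?A = "\<lambda>c j. {\<omega> \<in> space M. ?X n \<omega> = of_int c - of_int j * k}"
  let ?H = "\<lambda>j. {\<omega> \<in> space M. \<exists>m\<le>L. 0 + (\<Sum>i=n+1..n+m. eps i \<omega>) = real_of_int j}"
  let ?J = "{- int L..int L}" and ?I = "{- int C..int C}"
  let ?h = "\<lambda>j. if j = 0 then 1 else min 1 (real L / (real_of_int j)\<^sup>2)"
  have p0: "p \<ge> 0" using p[of 0] by (meson Ints_0 measure_nonneg order_trans)
  have past: "?A c j \<in> sets (past n)" for c j
    using measurable_sets[OF walk_past, of "{of_int c - of_int j * k}" a n]
    by (simp add: vimage_def Int_def conj_commute)
  have sum_meas: "(\<lambda>\<omega>. 0 + (\<Sum>i=n+1..n+m. eps i \<omega>)) \<in> borel_measurable M" for m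
    by (intro borel_measurable_add borel_measurable_sum eps_measurable) auto
  have H: "?H j \<in> events" for j
  proof -
    have "?H j = (\<Union>m\<le>L. {\<omega> \<in> space M. 0 + (\<Sum>i=n+1..n+m. eps i \<omega>) = real_of_int j})" by auto
    also have "\<dots> \<in> events"
      by (intro sets.finite_UN finite_atMost borel_measurable_eq sum_meas borel_measurable_const)
    finally show ?thesis .
  qed
  have AH: "?A c j \<inter> ?H j \<in> events" for c j
    by (intro sets.Int past_subset_events[OF past] H)
  have "AE \<omega> in M. (\<exists>i\<in>{n..n + L}. \<bar>?X i \<omega>\<bar> \<le> real C) \<longrightarrow>
      \<omega> \<in> (\<Union>(c, j)\<in>?I \<times> ?J. ?A c j \<inter> ?H j)"
    using AE_eps_sign AE_space
  proof eventually_elim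
    case (elim \<omega>)
    show ?case
    proof safe
      fix i assume i: "i \<in> {n..n + L}" and C: "\<bar>?X i \<omega>\<bar> \<le> real C"
      define m where "m = i - n"
      have m: "i = n + m" "m \<le> L" using i by (auto simp: m_def)
      have eps_int: "eps q \<omega> \<in> \<int>" if "q \<ge> 1" for q using elim(1) that by fastforce
      have "?X i \<omega> \<in> \<int>"
        unfolding rademacher_walk_def by (intro Ints_sum Ints_mult int eps_int) auto
      then obtain c where c: "?X i \<omega> = of_int c" by (auto elim: Ints_cases)
      have "(\<Sum>q=n+1..n+m. eps q \<omega>) \<in> \<int>" by (intro Ints_sum eps_int) auto
      then obtain j where j: "(\<Sum>q=n+1..n+m. eps q \<omega>) = of_int j" by (auto elim: Ints_cases)
      have "\<bar>\<Sum>q=n+1..n+m. eps q \<omega>\<bar> \<le> (\<Sum>q=n+1..n+m. \<bar>eps q \<omega>\<bar>)" by (rule sum_abs)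
      also have "\<dots> \<le> (\<Sum>q=n+1..n+m. 1)"
      proof (rule sum_mono)
        fix q assume "q \<in> {n+1..n+m}"
        then have "eps q \<omega> = 1 \<or> eps q \<omega> = - 1" using elim(1) by simp
        then show "\<bar>eps q \<omega>\<bar> \<le> 1" by auto
      qed
      finally have jm: "\<bar>j\<bar> \<le> int m" unfolding j by simp
      have "?X i \<omega> = ?X n \<omega> + (\<Sum>q=n+1..n+m. eps q \<omega> * a q)"
        unfolding rademacher_walk_def m by (rule sum.ub_add_nat) simp
      also have "(\<Sum>q=n+1..n+m. eps q \<omega> * a q) = (\<Sum>q=n+1..n+m. eps q \<omega> * k)"
        using m by (intro sum.cong refl) (auto simp: step)
      also have "\<dots> = of_int j * k" unfolding j[symmetric] by (rule sum_distrib_right[symmetric])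
      finally have "?X n \<omega> = of_int c - of_int j * k" using c by simp
      moreover have "c \<in> ?I" using C unfolding c by auto
      moreover have "j \<in> ?J" using jm m by auto
      ultimately show "\<omega> \<in> (\<Union>(c, j)\<in>?I \<times> ?J. ?A c j \<inter> ?H j)"
        using j m elim(2) by (intro UN_I[of "(c, j)"]) auto
    qed
  qed
  then have "\<P>(\<omega> in M. \<exists>i\<in>{n..n + L}. \<bar>?X i \<omega>\<bar> \<le> real C) \<le>
      prob (\<Union>(c, j)\<in>?I \<times> ?J. ?A c j \<inter> ?H j)"
    using AH by (intro finite_measure_mono_AE) (auto elim!: eventually_mono)
  also have "\<dots> \<le> (\<Sum>(c, j)\<in>?I \<times> ?J. prob (?A c j \<inter> ?H j))"
    unfolding case_prod_beta using AH by (intro finite_measure_subadditive_finite) auto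
  also have "\<dots> \<le> (\<Sum>(c, j)\<in>?I \<times> ?J. p * ?h j)"
  proof (intro sum_mono, clarify)
    fix c j
    have pA: "prob (?A c j) \<le> p" using k by (intro p) auto
    have "prob (?A c j \<inter> ?H j) \<le> prob (?A c j)"
      by (intro finite_measure_mono past_subset_events[OF past]) auto
    with pA have 1: "prob (?A c j \<inter> ?H j) \<le> p" by linarith
    have "prob (?A c j \<inter> ?H j) \<le> p * (real L / (real_of_int j)\<^sup>2)" if "j \<noteq> 0"
    proof -
      have "prob (?A c j \<inter> ?H j) \<le> prob (?A c j) * ((0\<^sup>2 + real L) / (real_of_int j)\<^sup>2)"
        using that by (intro prob_past_hit_le past) auto
      also have "\<dots> \<le> p * ((0\<^sup>2 + real L) / (real_of_int j)\<^sup>2)"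
        using pA by (intro mult_right_mono) auto
      finally show ?thesis by simp
    qed
    with 1 show "prob (?A c j \<inter> ?H j) \<le> p * ?h j" by (auto simp: min_def)
  qed
  also have "\<dots> = (2 * real C + 1) * p * (\<Sum>j\<in>?J. ?h j)"
    by (subst sum.cartesian_product[symmetric]) (simp add: sum_distrib_left algebra_simps)
  also have "(\<Sum>j\<in>?J. ?h j) \<le> 1 + 4 * sqrt (real L)"
  proof -
    let ?P = "int ` {1..L}" and ?N = "(\<lambda>j. - int j) ` {1..L}"
    have J: "?J = insert 0 (?P \<union> ?N)"
    proof (intro set_eqI iffI)
      fix j assume "j \<in> ?J"
      then show "j \<in> insert 0 (?P \<union> ?N)"
        by (cases j rule: int_cases3) (auto simp: image_iff)
    qed auto
    have "(\<Sum>j\<in>?J. ?h j) = 1 + ((\<Sum>j\<in>?P. ?h j) + (\<Sum>j\<in>?N. ?h j))"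
      unfolding J by (subst sum.insert) (auto simp: sum.union_disjoint intro!: sum.union_disjoint)
    also have "(\<Sum>j\<in>?P. ?h j) = (\<Sum>j=1..L. min 1 (real L / (real j)\<^sup>2))"
      by (subst sum.reindex) (auto intro!: sum.cong)
    also have "(\<Sum>j\<in>?N. ?h j) = (\<Sum>j=1..L. min 1 (real L / (real j)\<^sup>2))"
      by (subst sum.reindex) (auto intro!: sum.cong inj_onI)
    finally show ?thesis using sum_min_inverse_square_le[of "real L" L] by simp
  qed
  finally show ?thesis using p0 by (simp add: mult_left_mono)
qed

end

section \<open>Blocks of constant step size\<close>

definition log_step :: "real \<Rightarrow> nat \<Rightarrow> real" where
  "log_step \<alpha> n = real_of_int \<lfloor>ln (real n) powr \<alpha>\<rfloor>"

text \<open>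
  The last index whose step size is below \<open>k\<close>; the steps of size exactly \<open>k\<close> are those with
  indices in \<open>{block_end \<alpha> k<..block_end \<alpha> (Suc k)}\<close>. The subtraction makes the inequality
  \<open>n < exp (k powr (1 / \<alpha>))\<close> strict also when the exponential is an integer.
\<close>

definition block_end :: "real \<Rightarrow> nat \<Rightarrow> nat" where
  "block_end \<alpha> k = nat \<lceil>exp (real k powr (1 / \<alpha>))\<rceil> - 1"

lemma log_step_Ints [simp]: "log_step \<alpha> n \<in> \<int>"
  by (simp add: log_step_def)

lemma log_step_nonneg: "0 \<le> log_step \<alpha> n"
  by (simp add: log_step_def)

lemma block_end_bounds:
  "exp (real k powr (1 / \<alpha>)) - 1 \<le> real (block_end \<alpha> k)"
  "real (block_end \<alpha> k) < exp (real k powr (1 / \<alpha>))"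
proof -
  have "nat \<lceil>exp (real k powr (1 / \<alpha>))\<rceil> \<ge> 1"
    by (simp add: Suc_le_eq)
  then have "real (block_end \<alpha> k) = of_int \<lceil>exp (real k powr (1 / \<alpha>))\<rceil> - 1"
    by (simp add: block_end_def of_nat_diff)
  then show "exp (real k powr (1 / \<alpha>)) - 1 \<le> real (block_end \<alpha> k)"
    "real (block_end \<alpha> k) < exp (real k powr (1 / \<alpha>))"
    by linarith+
qed

lemma le_block_end_iff:
  assumes \<alpha>: "\<alpha> > 0" and n: "n \<ge> 1"
  shows "n \<le> block_end \<alpha> k \<longleftrightarrow> log_step \<alpha> n < real k"
proof -
  let ?y = "exp (real k powr (1 / \<alpha>))"
  have "n \<le> block_end \<alpha> k \<longleftrightarrow> int n < \<lceil>?y\<rceil>"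
    using n by (auto simp: block_end_def)
  also have "\<dots> \<longleftrightarrow> real n < ?y" by (simp add: less_ceiling_iff)
  also have "\<dots> \<longleftrightarrow> ln (real n) < real k powr (1 / \<alpha>)"
    using n by (metis exp_less_cancel_iff exp_ln of_nat_0_less_iff less_le_trans zero_less_one)
  also have "\<dots> \<longleftrightarrow> ln (real n) powr \<alpha> < (real k powr (1 / \<alpha>)) powr \<alpha>"
    using powr_less_mono2[of \<alpha> "ln (real n)" "real k powr (1 / \<alpha>)"]
      powr_mono2[of \<alpha> "real k powr (1 / \<alpha>)" "ln (real n)"] \<alpha> n
    by (auto simp: not_le[symmetric])
  also have "(real k powr (1 / \<alpha>)) powr \<alpha> = real k" using \<alpha> by (simp add: powr_powr)
  also have "ln (real n) powr \<alpha> < real k \<longleftrightarrow> log_step \<alpha> n < real k"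
    unfolding log_step_def by (metis floor_less_iff of_int_less_iff of_int_of_nat_eq)
  finally show ?thesis .
qed

lemma block_end_mono:
  assumes "\<alpha> > 0" "j \<le> k"
  shows "block_end \<alpha> j \<le> block_end \<alpha> k"
proof -
  have "\<lceil>exp (real j powr (1 / \<alpha>))\<rceil> \<le> \<lceil>exp (real k powr (1 / \<alpha>))\<rceil>"
    using assms by (intro ceiling_mono) (simp add: powr_mono2)
  then show ?thesis unfolding block_end_def by (intro diff_le_mono nat_mono)
qed

lemma log_step_eq_iff:
  assumes "\<alpha> > 0" "n \<ge> 1"
  shows "log_step \<alpha> n = real k \<longleftrightarrow> n \<in> {block_end \<alpha> k<..block_end \<alpha> (Suc k)}"
proof -
  obtain z where z: "log_step \<alpha> n = of_int z" using log_step_Ints by (rule Ints_cases)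
  have less: "log_step \<alpha> n < real m \<longleftrightarrow> z < int m" for m
    unfolding z by (metis of_int_less_iff of_int_of_nat_eq)
  have eq: "log_step \<alpha> n = real k \<longleftrightarrow> z = int k"
    unfolding z by (metis of_int_eq_iff of_int_of_nat_eq)
  have "log_step \<alpha> n = real k \<longleftrightarrow> \<not> log_step \<alpha> n < real k \<and> log_step \<alpha> n < real (Suc k)"
    unfolding less eq by linarith
  then show ?thesis
    using le_block_end_iff[OF assms, of k] le_block_end_iff[OF assms, of "Suc k"]
    by (metis greaterThanAtMost_iff not_le)
qed

text \<open>
  The left-hand side eventually exceeds every power of \<open>j\<close>, and this makes the second term of
  \<open>prob_walk_eq_le\<close> negligible.
\<close>

lemma card_log_step_eq_ge:
  assumes \<alpha>: "\<alpha> > 0" and j: "j < k"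
  shows "exp (real (Suc j) powr (1 / \<alpha>)) - exp (real j powr (1 / \<alpha>)) - 1 \<le>
    real (card {i\<in>{1..block_end \<alpha> k}. log_step \<alpha> i = real j})"
proof -
  have "{i\<in>{1..block_end \<alpha> k}. log_step \<alpha> i = real j} = {block_end \<alpha> j<..block_end \<alpha> (Suc j)}"
    using block_end_mono[OF \<alpha>, of "Suc j" k] j log_step_eq_iff[OF \<alpha>] by auto
  moreover have "block_end \<alpha> j \<le> block_end \<alpha> (Suc j)" by (rule block_end_mono[OF \<alpha>]) simp
  ultimately show ?thesis
    using block_end_bounds[where k = j and \<alpha> = \<alpha>] block_end_bounds[where k = "Suc j" and \<alpha> = \<alpha>]
    by (simp add: of_nat_diff del: of_nat_Suc)
qed

text \<open>
  All steps after time \<open>exp ((k / 2) powr (1 / \<alpha>))\<close>, a negligible part of the whole for large \<open>k\<close>,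
  have size at least \<open>k / 4\<close>. The variance is thus of the same order as if all steps had size \<open>k\<close>.
\<close>

lemma sum_log_step_sq_ge:
  assumes \<alpha>: "\<alpha> > 0" and k: "k \<ge> 2"
  shows "(exp (real k powr (1 / \<alpha>)) - 1 - exp ((real k / 2) powr (1 / \<alpha>))) * (real k / 4)\<^sup>2 \<le>
    (\<Sum>i=1..block_end \<alpha> k. (log_step \<alpha> i)\<^sup>2)"
proof -
  \<comment> \<open>Rounding \<open>k / 2\<close> down costs at most a factor \<open>2\<close>, hence the constant \<open>4\<close> in the bound.\<close>
  define h where "h = k div 2"
  have h: "h \<le> k" "real h \<le> real k / 2" "real k / 4 \<le> real h" using k by (auto simp: h_def)
  let ?I = "{block_end \<alpha> h<..block_end \<alpha> k}"
  have "real (block_end \<alpha> h) \<le> exp ((real k / 2) powr (1 / \<alpha>))"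
  proof -
    have "real (block_end \<alpha> h) \<le> exp (real h powr (1 / \<alpha>))" using block_end_bounds(2) less_imp_le by blast
    also have "\<dots> \<le> exp ((real k / 2) powr (1 / \<alpha>))" using h \<alpha> by (simp add: powr_mono2)
    finally show ?thesis .
  qed
  then have "exp (real k powr (1 / \<alpha>)) - 1 - exp ((real k / 2) powr (1 / \<alpha>)) \<le> real (card ?I)"
    using block_end_bounds(1)[where k = k and \<alpha> = \<alpha>] block_end_mono[OF \<alpha> h(1)]
    by (simp add: of_nat_diff)
  then have "(exp (real k powr (1 / \<alpha>)) - 1 - exp ((real k / 2) powr (1 / \<alpha>))) * (real k / 4)\<^sup>2 \<le>
      real (card ?I) * (real k / 4)\<^sup>2"
    by (rule mult_right_mono) simp
  also have "\<dots> = (\<Sum>i\<in>?I. (real k / 4)\<^sup>2)" by simp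
  also have "\<dots> \<le> (\<Sum>i\<in>?I. (log_step \<alpha> i)\<^sup>2)"
  proof (intro sum_mono power_mono)
    fix i assume i: "i \<in> ?I"
    then have "\<not> log_step \<alpha> i < real h" using le_block_end_iff[OF \<alpha>, of i h] by auto
    then show "real k / 4 \<le> log_step \<alpha> i" using h by linarith
  qed simp
  also have "\<dots> \<le> (\<Sum>i=1..block_end \<alpha> k. (log_step \<alpha> i)\<^sup>2)"
    by (intro sum_mono2) auto
  finally show ?thesis .
qed

section \<open>Transience\<close>

text \<open>
  At the start of block \<open>k\<close> the standard deviation is of order \<open>k * exp (k powr \<beta> / 2)\<close>. The sizes
  \<open>k - 2\<close> and \<open>k - 1\<close> serve as the two consecutive frequent steps: both occur at least
  \<open>exp (k powr \<beta> / 2)\<close> times, which makes the exponential term in the point bound negligible.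
\<close>

lemma eventually_prob_log_walk_eq_le:
  assumes "rademacher_sequence M eps" and \<alpha>: "\<alpha> > 1"
  shows "\<forall>\<^sub>F k in sequentially. \<forall>x\<in>\<int>.
    \<P>(\<omega> in M. rademacher_walk eps (log_step \<alpha>) (block_end \<alpha> k) \<omega> = x) \<le>
      19 / (real k * exp (real k powr (1 / \<alpha>) / 2))"
proof -
  interpret rademacher_sequence M eps by fact
  define b where "b = 1 / \<alpha>"
  have b: "0 < b" "b < 1" using \<alpha> by (auto simp: b_def)
  define c where "c = (1 / 2 :: real) powr b"
  have c: "0 < c" "c < 1" using b powr_less_mono2[of b "1/2" 1] by (auto simp: c_def)
  have ev1: "\<forall>\<^sub>F k in at_top. exp (k powr b) - 1 - exp (c * k powr b) \<ge> exp (k powr b) / (2::real)"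
    using b c by real_asymp
  have ev2: "\<forall>\<^sub>F k in at_top. exp ((k - 1) powr b) - exp ((k - 2) powr b) - 1 \<ge> exp (k powr b / (2::real)) + 1"
    using b by real_asymp
  have ev3: "\<forall>\<^sub>F k in at_top. exp (k powr b) - exp ((k - 1) powr b) - 1 \<ge> exp (k powr b / (2::real)) + 1"
    using b by real_asymp
  have ev4: "\<forall>\<^sub>F k in at_top. exp (- (exp (k powr b / 2) / (4 * k\<^sup>2))) \<le> 1 / (k * exp (k powr b / (2::real)))"
    using b by real_asymp
  note ev = ev1 ev2 ev3 ev4
  note ev' = ev[THEN eventually_compose_filterlim [OF _ filterlim_real_sequentially]]
  show ?thesis
    using ev' eventually_ge_at_top[of 2]
  proof eventually_elim
    case (elim k)
    \<comment> \<open>The factor \<open>6\<close> absorbs the losses \<open>2\<close> and \<open>4\<^sup>2\<close>, as \<open>2 * 16 \<le> 6\<^sup>2\<close>.\<close>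
    define D where "D = real k * exp (real k powr b / 2) / 6"
    define m where "m = nat \<lceil>exp (real k powr b / 2)\<rceil>"
    have m: "exp (real k powr b / 2) \<le> real m" "real m \<le> exp (real k powr b / 2) + 1"
      unfolding m_def by (simp_all add: of_nat_nat)
    define j where "j = k - 2"
    have j: "real k = real j + 2" "j < k" "Suc j < k" using elim(5) by (auto simp: j_def)
    have D0: "D > 0" using elim(5) by (simp add: D_def)
    have sq: "(exp (real k powr b / 2))\<^sup>2 = exp (real k powr b)" by (simp flip: exp_double)
    have "D\<^sup>2 \<le> exp (real k powr b) / 2 * (real k / 4)\<^sup>2"
      unfolding D_def power_mult_distrib power_divide sq by (simp add: field_simps)
    also have "\<dots> \<le> (exp (real k powr b) - 1 - exp (c * real k powr b)) * (real k / 4)\<^sup>2"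
      using elim(1) by (intro mult_right_mono) auto
    also have "c * real k powr b = (real k / 2) powr b"
      by (simp add: c_def powr_divide)
    also have "(exp (real k powr b) - 1 - exp ((real k / 2) powr b)) * (real k / 4)\<^sup>2 \<le>
        (\<Sum>i=1..block_end \<alpha> k. (log_step \<alpha> i)\<^sup>2)"
      unfolding b_def using \<alpha> elim(5) by (intro sum_log_step_sq_ge) auto
    finally have D: "D\<^sup>2 \<le> (\<Sum>i=1..block_end \<alpha> k. (log_step \<alpha> i)\<^sup>2)" .
    have card1: "m \<le> card {i\<in>{1..block_end \<alpha> k}. log_step \<alpha> i = real j}"
      using card_log_step_eq_ge[of \<alpha> j k] \<alpha> j elim(2) m by (simp add: b_def add.commute)
    have card2: "m \<le> card {i\<in>{1..block_end \<alpha> k}. log_step \<alpha> i = real j + 1}"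
      using card_log_step_eq_ge[of \<alpha> "Suc j" k] \<alpha> j elim(3) m by (simp add: b_def add.commute)
    show ?case
    proof
      fix x :: real assume x: "x \<in> \<int>"
      have "\<P>(\<omega> in M. rademacher_walk eps (log_step \<alpha>) (block_end \<alpha> k) \<omega> = x) \<le>
          3 / D + exp (- (real m / (4 * (real k)\<^sup>2)))"
      proof (rule prob_walk_eq_le[OF _ x _ _ D0 D card1 card2])
        fix i assume "i \<in> {1..block_end \<alpha> k}"
        then show "0 \<le> log_step \<alpha> i \<and> log_step \<alpha> i \<le> real k"
          using le_block_end_iff[of \<alpha> i k] \<alpha> log_step_nonneg[of \<alpha> i] by auto
      qed (use elim(5) in auto)
      also have "exp (- (real m / (4 * (real k)\<^sup>2))) \<le> exp (- (exp (real k powr b / 2) / (4 * (real k)\<^sup>2)))"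
        using m by (simp add: divide_right_mono)
      also have "\<dots> \<le> 1 / (real k * exp (real k powr b / 2))" by (rule elim(4))
      also have "3 / D = 18 / (real k * exp (real k powr b / 2))" by (simp add: D_def)
      finally show "\<P>(\<omega> in M. rademacher_walk eps (log_step \<alpha>) (block_end \<alpha> k) \<omega> = x) \<le>
          19 / (real k * exp (real k powr (1 / \<alpha>) / 2))"
        by (simp add: b_def flip: add_divide_distrib)
    qed
  qed
qed

text \<open>
  The block visit bound is a constant times \<open>sqrt (L / N) / k\<close>, and \<open>L / N\<close> is at most
  \<open>R k = exp ((k + 1) powr \<beta> - k powr \<beta>) - 1 + exp (- k powr \<beta>)\<close> with \<open>N\<close> replaced by
  \<open>exp (k powr \<beta>)\<close>. The increment of \<open>k powr \<beta>\<close> is of order \<open>k powr (\<beta> - 1)\<close>, so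
  \<open>\<alpha> > 1\<close> gives the summable exponent \<open>(\<beta> - 3) / 2 < - 1\<close>.
\<close>

lemma summable_prob_log_block_visit:
  fixes C :: nat
  assumes "rademacher_sequence M eps" and \<alpha>: "\<alpha> > 1"
  shows "summable (\<lambda>k. \<P>(\<omega> in M. \<exists>i\<in>{block_end \<alpha> k..block_end \<alpha> (Suc k)}.
    \<bar>rademacher_walk eps (log_step \<alpha>) i \<omega>\<bar> \<le> real C))"
    (is "summable ?q")
proof -
  interpret rademacher_sequence M eps by fact
  define b where "b = 1 / \<alpha>"
  have b: "0 < b" "b < 1" using \<alpha> by (auto simp: b_def)
  define R :: "real \<Rightarrow> real" where "R = (\<lambda>k. exp ((k + 1) powr b - k powr b) - 1 + exp (- (k powr b)))"
  have R: "R \<in> O(\<lambda>k. k powr (b - 1))"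
    unfolding R_def using b by real_asymp
  then obtain c where c: "\<forall>\<^sub>F k in at_top. norm (R k) \<le> c * norm (k powr (b - 1))"
    by (auto elim: landau_o.bigE)
  have "\<forall>\<^sub>F k in sequentially. norm (sqrt (R (real k)) / real k) \<le> sqrt c * real k powr ((b - 3) / 2)"
    using eventually_compose_filterlim[OF c filterlim_real_sequentially] eventually_gt_at_top[of 0]
  proof eventually_elim
    case (elim k)
    have "norm (sqrt (R (real k))) = sqrt \<bar>R (real k)\<bar>" by (simp add: real_sqrt_abs')
    also have "\<dots> \<le> sqrt (c * real k powr (b - 1))" using elim(1) by simp
    also have "\<dots> = sqrt c * real k powr ((b - 1) / 2)"
      by (simp add: real_sqrt_mult powr_powr flip: powr_half_sqrt)
    finally have "norm (sqrt (R (real k)) / real k) \<le> sqrt c * real k powr ((b - 1) / 2) / real k"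
      by (simp add: divide_right_mono)
    also have "\<dots> = sqrt c * real k powr ((b - 3) / 2)"
      using elim(2) powr_diff[of "real k" "(b - 1) / 2" 1] by (simp add: diff_divide_distrib)
    finally show ?case .
  qed
  moreover have "summable (\<lambda>k. sqrt c * real k powr ((b - 3) / 2))"
    using b by (intro summable_mult) (simp add: summable_real_powr_iff)
  ultimately have "summable (\<lambda>k. sqrt (R (real k)) / real k)"
    by (rule summable_comparison_test_ev)
  then have "summable (\<lambda>k. 95 * (2 * real C + 1) * (sqrt (R (real k)) / real k))"
    by (intro summable_mult)
  moreover have "\<forall>\<^sub>F k in sequentially. norm (?q k) \<le> 95 * (2 * real C + 1) * (sqrt (R (real k)) / real k)"
    using eventually_prob_log_walk_eq_le[OF assms] eventually_gt_at_top[of 0]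
  proof eventually_elim
    case (elim k)
    let ?E = "exp (real k powr b)"
    define L where "L = block_end \<alpha> (Suc k) - block_end \<alpha> k"
    have L: "block_end \<alpha> (Suc k) = block_end \<alpha> k + L"
      using block_end_mono[of \<alpha> k "Suc k"] \<alpha> by (simp add: L_def)
    have "?q k \<le> (2 * real C + 1) * (19 / (real k * exp (real k powr b / 2))) * (1 + 4 * sqrt (real L))"
      unfolding L
    proof (rule prob_block_visit_le [where k = "real k"])
      show "log_step \<alpha> i = real k" if "i \<in> {block_end \<alpha> k<..block_end \<alpha> k + L}" for i
        using that \<alpha> L by (subst log_step_eq_iff) auto
    qed (use elim in \<open>auto simp: b_def\<close>)
    also have "\<dots> \<le> (2 * real C + 1) * (19 / (real k * exp (real k powr b / 2))) *
        (5 * (exp (real k powr b / 2) * sqrt (R (real k))))"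
    proof (rule mult_left_mono)
      have sq: "exp (real k powr b / 2) = sqrt ?E"
        by (rule real_sqrt_unique [symmetric]) (auto simp flip: exp_double)
      have "R (real k) * ?E = exp ((real k + 1) powr b) - ?E + 1"
        by (simp add: R_def algebra_simps flip: exp_add)
      moreover have "?E \<le> exp ((real k + 1) powr b)" using b by (simp add: powr_mono2)
      moreover have "real L \<le> exp ((real k + 1) powr b) - ?E + 1"
        using block_end_bounds[where k = "Suc k" and \<alpha> = \<alpha>] block_end_bounds[where k = k and \<alpha> = \<alpha>] L
        by (simp add: b_def add.commute)
      ultimately have "1 \<le> sqrt (R (real k) * ?E)" "sqrt (real L) \<le> sqrt (R (real k) * ?E)"
        by simp_all
      then show "1 + 4 * sqrt (real L) \<le> 5 * (exp (real k powr b / 2) * sqrt (R (real k)))"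
        unfolding sq by (simp add: real_sqrt_mult mult.commute)
    qed simp
    also have "\<dots> = 95 * (2 * real C + 1) * (sqrt (R (real k)) / real k)"
      by simp
    finally show ?case by simp
  qed
  ultimately show ?thesis by (rule summable_comparison_test_ev [rotated])
qed

theorem corollary6:
  fixes M :: "'a measure" and eps :: "nat \<Rightarrow> 'a \<Rightarrow> real" and \<alpha> :: real
  assumes "rademacher_sequence M eps"
    and "\<alpha> > 1"
  shows "transient M (rademacher_walk eps (\<lambda>n. real_of_int \<lfloor>ln (real n) powr \<alpha>\<rfloor>))"
proof -
  interpret rademacher_sequence M eps by fact
  have \<alpha>: "\<alpha> > 0" using assms(2) by simp
  let ?X = "rademacher_walk eps (log_step \<alpha>)"
  \<comment> \<open>Almost surely only finitely many blocks are visited, and each of them is finite.\<close>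
  have "AE \<omega> in M. \<not> (\<exists>\<^sub>\<infinity>n. \<bar>?X n \<omega>\<bar> \<le> real C)" for C
  proof -
    let ?A = "\<lambda>k. {\<omega> \<in> space M. \<exists>i\<in>{block_end \<alpha> k..block_end \<alpha> (Suc k)}. \<bar>?X i \<omega>\<bar> \<le> real C}"
    have "AE \<omega> in M. \<forall>\<^sub>F k in sequentially. \<omega> \<in> space M - ?A k"
      using summable_prob_log_block_visit[OF assms]
      by (intro borel_cantelli_AE1) (auto simp: less_top[symmetric])
    then show ?thesis
    proof eventually_elim
      case (elim \<omega>)
      then obtain K where K: "\<And>k. k \<ge> K \<Longrightarrow> \<omega> \<in> space M - ?A k"
        by (auto simp: eventually_sequentially)
      have "\<not> \<bar>?X n \<omega>\<bar> \<le> real C" if n: "n > block_end \<alpha> K" for n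
      proof -
        obtain z where z: "log_step \<alpha> n = of_int z" using log_step_Ints by (rule Ints_cases)
        define k where "k = nat z"
        have k: "log_step \<alpha> n = real k" using z log_step_nonneg[of \<alpha> n] by (simp add: k_def)
        have n1: "n \<ge> 1" using n by simp
        have "\<not> log_step \<alpha> n < real K" using le_block_end_iff[OF \<alpha> n1, of K] n by simp
        then have "K \<le> k" using k by simp
        moreover have "n \<in> {block_end \<alpha> k..block_end \<alpha> (Suc k)}"
          using log_step_eq_iff[OF \<alpha> n1, of k] k by simp
        ultimately show ?thesis using K[of k] by blast
      qed
      then show ?case
        unfolding not_INFM MOST_nat by blast
    qed
  qed
  then have "AE \<omega> in M. \<forall>C::nat. \<not> (\<exists>\<^sub>\<infinity>n. \<bar>?X n \<omega>\<bar> \<le> real C)"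
    by (simp add: AE_all_countable)
  then have "AE \<omega> in M. \<not> (\<exists>C. \<exists>\<^sub>\<infinity>n. \<bar>?X n \<omega>\<bar> \<le> C)"
  proof eventually_elim
    case (elim \<omega>)
    show ?case
    proof
      assume "\<exists>C. \<exists>\<^sub>\<infinity>n. \<bar>?X n \<omega>\<bar> \<le> C"
      then obtain C where C: "\<exists>\<^sub>\<infinity>n. \<bar>?X n \<omega>\<bar> \<le> C" by blast
      obtain N :: nat where "C \<le> real N" using real_arch_simple by blast
      with C have "\<exists>\<^sub>\<infinity>n. \<bar>?X n \<omega>\<bar> \<le> real N" by (auto elim!: INFM_mono)
      with elim show False by blast
    qed
  qed
  then have "\<P>(\<omega> in M. \<exists>C. \<exists>\<^sub>\<infinity>n. \<bar>?X n \<omega>\<bar> \<le> C) = 0"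
    using weak_recurrence_event_measurable[of "log_step \<alpha>"] by (subst prob_Collect_eq_0)
  then show ?thesis
    unfolding transient_def weakly_recurrent_def log_step_def [abs_def] by simp
qed

end
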